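(* Let $b>0$, $0<\alpha<1$, and let $f,g\in H^1(0,b)$. Then $$\int_0^b ({}^{ABC}{}_{0}D^\alpha f)(t)\,g(t)\,dt=\int_0^b f(t)\,({}^{ABR}D_b^\alpha g)(t)\,dt+\frac{B(\alpha)}{1-\alpha}\Big[f(t)\,\big(\mathbf{E}^1_{\alpha,1,\frac{-\alpha}{1-\alpha},b^-}g\big)(t)\Big]_{t=0}^{t=b}$$ and $$\int_0^b ({}^{ABC}D_b^\alpha f)(t)\,g(t)\,dt=\int_0^b f(t)\,({}^{ABR}{}_{0}D^\alpha g)(t)\,dt-\frac{B(\alpha)}{1-\alpha}\Big[f(t)\,\big(\mathbf{E}^1_{\alpha,1,\frac{-\alpha}{1-\alpha},0^+}g\big)(t)\Big]_{t=0}^{t=b}.$$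
   Context: $B(\alpha)>0$ is a normalization constant depending on $\alpha$. $E_\alpha(z)=\sum_{k\ge0}\frac{z^k}{\Gamma(\alpha k+1)}$ is the Mittag-Leffler function, and $E^\gamma_{\rho,\mu}(z)=\sum_{k\ge0}\frac{(\gamma)_k z^k}{\Gamma(\rho k+\mu)\,k!}$ (with $(\gamma)_k$ the Pochhammer symbol) is the generalized Mittag-Leffler function, for complex $\rho,\mu,\gamma$ with $\mathrm{Re}(\rho)>0$. The left and right fractional derivatives with Mittag-Leffler kernel on $[0,b]$, of Caputo type (ABC) and Riemann-Liouville type (ABR), are $$({}^{ABC}{}_{0}D^\alpha f)(t)=\frac{B(\alpha)}{1-\alpha}\int_0^t f'(x)E_\alpha\!\left[-\alpha\tfrac{(t-x)^\alpha}{1-\alpha}\right]dx,\quad ({}^{ABC}D_b^\alpha f)(t)=-\frac{B(\alpha)}{1-\alpha}\int_t^b f'(x)E_\alpha\!\left[-\alpha\tfrac{(x-t)^\alpha}{1-\alpha}\right]dx,$$ $$({}^{ABR}{}_{0}D^\alpha f)(t)=\frac{B(\alpha)}{1-\alpha}\frac{d}{dt}\int_0^t f(x)E_\alpha\!\left[-\alpha\tfrac{(t-x)^\alpha}{1-\alpha}\right]dx,\quad ({}^{ABR}D_b^\alpha f)(t)=-\frac{B(\alpha)}{1-\alpha}\frac{d}{dt}\int_t^b f(x)E_\alpha\!\left[-\alpha\tfrac{(x-t)^\alpha}{1-\alpha}\right]dx.$$ The left and right generalized fractional integral operators are $$(\mathbf{E}^\gamma_{\rho,\mu,\omega,a^+}\varphi)(x)=\int_a^x(x-t)^{\mu-1}E^\gamma_{\rho,\mu}[\omega(x-t)^\rho]\varphi(t)\,dt\quad(x>a),$$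 $$(\mathbf{E}^\gamma_{\rho,\mu,\omega,b^-}\varphi)(x)=\int_x^b(t-x)^{\mu-1}E^\gamma_{\rho,\mu}[\omega(t-x)^\rho]\varphi(t)\,dt\quad(x<b),$$ with value $0$ (empty integral) at $x=a$, respectively $x=b$. Elements of $H^1(0,b)$ are identified with their continuous representatives on $[0,b]$, and $[F(t)]_{t=0}^{t=b}=F(b)-F(0)$. *)

theory Defs
  imports "HOL-Analysis.Analysis"
begin

section \<open>The Sobolev space $H^1(0,b)$\<close>

definition L2 :: "real \<Rightarrow> (real \<Rightarrow> real) set" where
  "L2 b = {f. set_borel_measurable lborel {0<..<b} f \<and>
              set_integrable lborel {0<..<b} (\<lambda>x. (f x)\<^sup>2)}"

definition test_functions :: "real \<Rightarrow> (real \<Rightarrow> real) set" where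
  "test_functions b = {\<phi>. (\<forall>n. (deriv ^^ n) \<phi> differentiable_on UNIV) \<and>
                          compact (closure {x. \<phi> x \<noteq> 0}) \<and>
                          closure {x. \<phi> x \<noteq> 0} \<subseteq> {0<..<b}}"

definition has_weak_deriv :: "real \<Rightarrow> (real \<Rightarrow> real) \<Rightarrow> (real \<Rightarrow> real) \<Rightarrow> bool" where
  "has_weak_deriv b f df \<longleftrightarrow>
     (\<forall>\<phi>\<in>test_functions b.
        (LINT x:{0<..<b}|lborel. f x * deriv \<phi> x) = - (LINT x:{0<..<b}|lborel. df x * \<phi> x))"

text \<open>The elements of \<open>H1 b\<close> are the continuous representatives on \<open>[0,b]\<close>; values
  outside \<open>[0,b]\<close> are unconstrained and play no role.\<close>

definition H1 :: "real \<Rightarrow> (real \<Rightarrow> real) set" where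
  "H1 b = {f. continuous_on {0..b} f \<and> f \<in> L2 b \<and> (\<exists>df\<in>L2 b. has_weak_deriv b f df)}"

text \<open>The weak derivative is determined only almost everywhere; this picks an arbitrary
  representative. It occurs below only under integrals.\<close>

definition weak_deriv :: "real \<Rightarrow> (real \<Rightarrow> real) \<Rightarrow> real \<Rightarrow> real" where
  "weak_deriv b f = (SOME df. df \<in> L2 b \<and> has_weak_deriv b f df)"


section \<open>Mittag-Leffler functions\<close>

text \<open>The definitions are polymorphic: at type \<^typ>\<open>complex\<close> they are the usual functions with
  complex parameters, at type \<^typ>\<open>real\<close> their restrictions to real parameters and arguments.
  At a pole \<open>Gamma\<close> is \<open>0\<close> and division by \<open>0\<close> gives \<open>0\<close>, which agrees with the convention
  that the reciprocal Gamma function vanishes there.\<close>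

definition mittag_leffler :: "'a::Gamma \<Rightarrow> 'a \<Rightarrow> 'a" where
  "mittag_leffler \<alpha> z = (\<Sum>k. z ^ k / Gamma (\<alpha> * of_nat k + 1))"

definition gen_mittag_leffler :: "'a::Gamma \<Rightarrow> 'a \<Rightarrow> 'a \<Rightarrow> 'a \<Rightarrow> 'a" where
  "gen_mittag_leffler \<gamma> \<rho> \<mu> z =
     (\<Sum>k. pochhammer \<gamma> k * z ^ k / (Gamma (\<rho> * of_nat k + \<mu>) * fact k))"


section \<open>Generalized fractional integral operators\<close>

text \<open>Argument order: \<open>\<gamma> \<rho> \<mu> \<omega>\<close>, end point, function, point of evaluation. For \<open>\<mu> = 1\<close> the
  first factor is \<open>0 powr 0 = 0\<close> instead of \<open>1\<close> at the end point \<open>t = x\<close>, which is a null set.\<close>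

definition gen_frac_int_left ::
  "'a \<Rightarrow> 'a \<Rightarrow> 'a \<Rightarrow> 'a \<Rightarrow> real \<Rightarrow> (real \<Rightarrow> 'a) \<Rightarrow> real \<Rightarrow> 'a::{Gamma,ln,second_countable_topology}"
where
  "gen_frac_int_left \<gamma> \<rho> \<mu> \<omega> a \<phi> x =
     (LINT t:{a..x}|lborel. of_real (x - t) powr (\<mu> - 1) *
        gen_mittag_leffler \<gamma> \<rho> \<mu> (\<omega> * of_real (x - t) powr \<rho>) * \<phi> t)"

definition gen_frac_int_right ::
  "'a \<Rightarrow> 'a \<Rightarrow> 'a \<Rightarrow> 'a \<Rightarrow> real \<Rightarrow> (real \<Rightarrow> 'a) \<Rightarrow> real \<Rightarrow> 'a::{Gamma,ln,second_countable_topology}"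
where
  "gen_frac_int_right \<gamma> \<rho> \<mu> \<omega> b \<phi> x =
     (LINT t:{x..b}|lborel. of_real (t - x) powr (\<mu> - 1) *
        gen_mittag_leffler \<gamma> \<rho> \<mu> (\<omega> * of_real (t - x) powr \<rho>) * \<phi> t)"


section \<open>Fractional derivatives with Mittag-Leffler kernel on $[0,b]$\<close>

definition ABC_left ::
  "(real \<Rightarrow> real) \<Rightarrow> real \<Rightarrow> real \<Rightarrow> (real \<Rightarrow> real) \<Rightarrow> real \<Rightarrow> real" where
  "ABC_left B b \<alpha> f t = B \<alpha> / (1 - \<alpha>) *
     (LINT x:{0..t}|lborel. weak_deriv b f x *
        mittag_leffler \<alpha> (- \<alpha> * ((t - x) powr \<alpha> / (1 - \<alpha>))))"

definition ABC_right ::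
  "(real \<Rightarrow> real) \<Rightarrow> real \<Rightarrow> real \<Rightarrow> (real \<Rightarrow> real) \<Rightarrow> real \<Rightarrow> real" where
  "ABC_right B b \<alpha> f t = - (B \<alpha> / (1 - \<alpha>)) *
     (LINT x:{t..b}|lborel. weak_deriv b f x *
        mittag_leffler \<alpha> (- \<alpha> * ((x - t) powr \<alpha> / (1 - \<alpha>))))"

text \<open>The derivative in \<open>t\<close> is taken relative to \<open>[0,b]\<close>: it is the ordinary derivative in the
  interior and one-sided at the end points.\<close>

definition ABR_left ::
  "(real \<Rightarrow> real) \<Rightarrow> real \<Rightarrow> real \<Rightarrow> (real \<Rightarrow> real) \<Rightarrow> real \<Rightarrow> real" where
  "ABR_left B b \<alpha> f t = B \<alpha> / (1 - \<alpha>) *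
     vector_derivative
       (\<lambda>s. LINT x:{0..s}|lborel. f x *
          mittag_leffler \<alpha> (- \<alpha> * ((s - x) powr \<alpha> / (1 - \<alpha>))))
       (at t within {0..b})"

definition ABR_right ::
  "(real \<Rightarrow> real) \<Rightarrow> real \<Rightarrow> real \<Rightarrow> (real \<Rightarrow> real) \<Rightarrow> real \<Rightarrow> real" where
  "ABR_right B b \<alpha> f t = - (B \<alpha> / (1 - \<alpha>)) *
     vector_derivative
       (\<lambda>s. LINT x:{s..b}|lborel. f x *
          mittag_leffler \<alpha> (- \<alpha> * ((x - s) powr \<alpha> / (1 - \<alpha>))))
       (at t within {0..b})"

end

theory Submission
  imports Defs
begin

text \<open>Let \<open>k u = E\<^sub>\<alpha>(- \<alpha> / (1 - \<alpha>) * u powr \<alpha>)\<close>, a continuous kernel, and let \<open>L\<close> and \<open>R\<close> be the left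
  and right convolution with \<open>k\<close> on \<open>[0,b]\<close>. Fubini on the triangle shows that \<open>L\<close> and \<open>R\<close> are adjoint,
  so \<open>\<integral> (L f') g = \<integral> f' (R g)\<close>. By the du Bois-Reymond lemma an \<open>H\<^sup>1\<close> function is an indefinite
  integral of its weak derivative, hence \<open>L g\<close> is the indefinite integral of \<open>g 0 * k + L g'\<close>; this
  integrand is continuous, so \<open>L g\<close> and, by reflection, \<open>R g\<close> are continuously differentiable, and
  ordinary integration by parts moves the derivative from \<open>f\<close> onto \<open>R g\<close>, leaving the boundary term.
  The second identity is the same argument with \<open>L\<close> and \<open>R\<close> exchanged.\<close>

section \<open>The Mittag-Leffler kernel\<close>

text \<open>Integrating only over \<open>[R, R + 1]\<close> in Euler's integral suffices: choosing \<open>R\<close> with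
  \<open>R powr \<alpha> = 2 * \<bar>z\<bar> + 1\<close> makes the Mittag-Leffler series geometrically dominated.\<close>

lemma Gamma_ge_powr:
  fixes x R :: real
  assumes "x \<ge> 0" "R \<ge> 1"
  shows "R powr x * exp (- (R + 1)) \<le> Gamma (x + 1)"
proof -
  have *: "((\<lambda>t. t powr x / exp t) has_integral Gamma (x + 1)) {0..}"
    using Gamma_integral_real[of "x + 1"] assms by simp
  have "((\<lambda>t. R powr x * exp (- (R + 1))) has_integral R powr x * exp (- (R + 1))) {R..R+1}"
    using has_integral_const_real[of "R powr x * exp (- (R + 1))" R "R+1"] by simp
  then have "((\<lambda>t. if t \<in> {R..R+1} then R powr x * exp (- (R + 1)) else 0)
      has_integral R powr x * exp (- (R + 1))) {0..}"
    using assms by (subst has_integral_restrict) auto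
  then show ?thesis
  proof (rule has_integral_le[OF _ *])
    fix t :: real
    assume t: "t \<in> {0..}"
    show "(if t \<in> {R..R+1} then R powr x * exp (- (R + 1)) else 0) \<le> t powr x / exp t"
    proof (cases "t \<in> {R..R+1}")
      case True
      then have "R powr x * exp (- (R + 1)) \<le> t powr x * exp (- t)"
        using assms by (intro mult_mono powr_mono2) auto
      also have "\<dots> = t powr x / exp t" by (simp add: exp_minus field_simps)
      finally show ?thesis by (simp only: if_P[OF True])
    next
      case False
      then show ?thesis by (simp only: if_False) simp
    qed
  qed
qed

lemma summable_mittag_leffler:
  fixes \<alpha> z :: real
  assumes "\<alpha> > 0"
  shows "summable (\<lambda>k. (1 / Gamma (\<alpha> * real k + 1)) * z ^ k)"
proof -
  define q where "q = 2 * \<bar>z\<bar> + 1"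
  define R where "R = q powr (1 / \<alpha>)"
  have q: "q \<ge> 1" by (simp add: q_def)
  have R: "R \<ge> 1" using q assms by (simp add: R_def ge_one_powr_ge_zero)
  show ?thesis
  proof (rule summable_comparison_test')
    show "summable (\<lambda>k. exp (R + 1) * (1 / 2) ^ k :: real)"
      by (intro summable_mult summable_geometric) simp
    fix k :: nat
    have "R powr (\<alpha> * k) = q ^ k"
      using q assms by (simp add: R_def powr_powr powr_realpow)
    then have G: "q ^ k * exp (- (R + 1)) \<le> Gamma (\<alpha> * real k + 1)"
      using Gamma_ge_powr[of "\<alpha> * k" R] R assms by simp
    have G0: "Gamma (\<alpha> * real k + 1) > 0" using assms by (intro Gamma_real_pos add_nonneg_pos) auto
    \<comment> \<open>The choice of \<open>q\<close> gives \<open>\<bar>z\<bar> \<le> q / 2\<close>;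
      the factor \<open>q ^ k\<close> is absorbed by the Gamma bound and \<open>(1/2) ^ k\<close>
      remains as geometric majorant.\<close>
    have "\<bar>z\<bar> ^ k \<le> (q * (1/2)) ^ k"
      by (rule power_mono) (auto simp: q_def)
    also have "\<dots> = exp (R + 1) * exp (- (R + 1)) * (q ^ k * (1/2) ^ k)"
      by (simp only: power_mult_distrib flip: exp_add) simp
    also have "\<dots> = exp (R + 1) * (1/2)^k * (q ^ k * exp (- (R + 1)))"
      by (simp only: ac_simps)
    also have "\<dots> \<le> exp (R + 1) * (1/2)^k * Gamma (\<alpha> * real k + 1)"
      using G by (intro mult_left_mono) auto
    finally show "norm (1 / Gamma (\<alpha> * real k + 1) * z ^ k) \<le> exp (R + 1) * (1/2)^k"
      using G0 by (simp add: abs_mult power_abs field_simps)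
  qed
qed

lemma isCont_mittag_leffler:
  fixes \<alpha> z :: real
  assumes "\<alpha> > 0"
  shows "isCont (mittag_leffler \<alpha>) z"
proof -
  have "mittag_leffler \<alpha> = (\<lambda>z. \<Sum>k. (1 / Gamma (\<alpha> * real k + 1)) * z ^ k)"
    by (simp add: mittag_leffler_def fun_eq_iff)
  then show ?thesis
    using isCont_powser_converges_everywhere[of "\<lambda>k. 1 / Gamma (\<alpha> * real k + 1)" z]
      summable_mittag_leffler[OF assms] by simp
qed

text \<open>The Pochhammer symbol of 1 is the factorial and cancels against
  \<open>fact k\<close>.\<close>

lemma gen_mittag_leffler_1: "gen_mittag_leffler 1 \<alpha> 1 z = mittag_leffler \<alpha> (z::real)"
  by (simp add: gen_mittag_leffler_def mittag_leffler_def flip: pochhammer_fact)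

text \<open>The absolute value extends the kernel to a continuous function on the whole line.\<close>

definition ml_kernel :: "real \<Rightarrow> real \<Rightarrow> real" where
  "ml_kernel \<alpha> u = mittag_leffler \<alpha> (- \<alpha> * (\<bar>u\<bar> powr \<alpha> / (1 - \<alpha>)))"

lemma continuous_on_ml_kernel:
  assumes "0 < \<alpha>" "\<alpha> < 1"
  shows "continuous_on UNIV (ml_kernel \<alpha>)"
proof -
  have "continuous_on UNIV (mittag_leffler \<alpha> :: real \<Rightarrow> real)"
    using isCont_mittag_leffler[OF assms(1)] by (simp add: continuous_at_imp_continuous_on)
  \<comment> \<open>Positivity of \<open>\<alpha>\<close> makes the power continuous also at
    \<open>u = 0\<close>, where the base vanishes.\<close>
  moreover have "continuous_on UNIV (\<lambda>u::real. - \<alpha> * (\<bar>u\<bar> powr \<alpha> / (1 - \<alpha>)))"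
    using assms by (intro continuous_intros continuous_on_powr') auto
  ultimately show ?thesis
    unfolding ml_kernel_def by (rule continuous_on_compose2) auto
qed

section \<open>One-sided convolutions\<close>

text \<open>The kernel is a parameter so that the constant kernel 1 is covered too:
  \<open>lconv (\<lambda>_. 1)\<close> is the indefinite integral from \<open>0\<close>,
  \<open>rconv (\<lambda>_. 1) b\<close> the one up to \<open>b\<close>.\<close>

definition lconv :: "(real \<Rightarrow> real) \<Rightarrow> (real \<Rightarrow> real) \<Rightarrow> real \<Rightarrow> real" where
  "lconv k \<phi> t = (LINT x:{0..t}|lborel. \<phi> x * k (t - x))"

definition rconv :: "(real \<Rightarrow> real) \<Rightarrow> real \<Rightarrow> (real \<Rightarrow> real) \<Rightarrow> real \<Rightarrow> real" where
  "rconv k b \<phi> t = (LINT x:{t..b}|lborel. \<phi> x * k (x - t))"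

text \<open>Both sides integrate \<open>h x * g t * k (t - x)\<close> over the triangle
  \<open>0 \<le> x \<le> t \<le> T\<close>, in the two orders. Boundedness of \<open>k\<close> on
  \<open>{-T..T}\<close> supplies an integrable majorant.\<close>

lemma triangle_Fubini:
  fixes h g k :: "real \<Rightarrow> real" and T :: real
  assumes k: "continuous_on UNIV k" and h: "set_integrable lborel {0..T} h" and g: "set_integrable lborel {0..T} g"
  shows "(LINT t:{0..T}|lborel. lconv k h t * g t) = (LINT x:{0..T}|lborel. h x * rconv k T g x)"
proof -
  let ?h = "\<lambda>x. indicator {0..T} x * h x" and ?g = "\<lambda>x. indicator {0..T} x * g x"
  have hi: "integrable lborel ?h" and gi: "integrable lborel ?g"
    using h g by (auto simp: set_integrable_def)
  have [measurable]: "?h \<in> borel_measurable borel" "?g \<in> borel_measurable borel"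
    using hi gi by auto
  have [measurable]: "k \<in> borel_measurable borel" using k by (rule borel_measurable_continuous_onI)
  have "compact (k ` {-T..T})"
    using k by (intro compact_continuous_image) (auto intro: continuous_on_subset)
  then obtain M where M: "\<And>u. u \<in> {-T..T} \<Longrightarrow> \<bar>k u\<bar> \<le> M"
    by (meson bounded_real compact_imp_bounded imageI)
  define F where "F x t = ?h x * ?g t * (if x \<le> t then k (t - x) else 0)" for x t
  have Fm[measurable]: "case_prod F \<in> borel_measurable (lborel \<Otimes>\<^sub>M lborel)"
    unfolding F_def by measurable
  have Hi: "integrable (lborel \<Otimes>\<^sub>M lborel) (\<lambda>(x,t). M * (?h x * ?g t))"
  proof (rule lborel_pair.Fubini_integrable)
    show "(\<lambda>(x,t). M * (?h x * ?g t)) \<in> borel_measurable (lborel \<Otimes>\<^sub>M lborel)" by measurable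
    have "integrable lborel (\<lambda>x. \<bar>M\<bar> * \<bar>?h x\<bar> * (\<integral>t. \<bar>?g t\<bar> \<partial>lborel))"
      using hi by auto
    then show "integrable lborel (\<lambda>x. \<integral>y. norm (case (x, y) of (x, t) \<Rightarrow> M * (?h x * ?g t)) \<partial>lborel)"
      by (simp add: abs_mult mult.assoc)
    show "AE x in lborel. integrable lborel (\<lambda>y. case (x, y) of (x, t) \<Rightarrow> M * (?h x * ?g t))"
      using gi by auto
  qed
  have Fi: "integrable (lborel \<Otimes>\<^sub>M lborel) (case_prod F)"
  proof (rule Bochner_Integration.integrable_bound[OF Hi Fm], rule AE_I2, clarify)
    fix x t :: real
    have "\<bar>F x t\<bar> \<le> M * \<bar>?h x * ?g t\<bar>"
    proof (cases "x \<in> {0..T} \<and> t \<in> {0..T} \<and> x \<le> t")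
      case True
      then have "\<bar>k (t - x)\<bar> \<le> M" by (intro M) auto
      then show ?thesis using True by (auto simp: F_def abs_mult mult.commute intro!: mult_right_mono)
    next
      case False
      \<comment> \<open>If \<open>x\<close> and \<open>t\<close> both lie in the interval, the bound
        at \<open>0\<close> shows that \<open>M\<close> is nonnegative; otherwise both sides
        vanish.\<close>
      then show ?thesis using M[of 0]
        by (cases "x \<in> {0..T}"; cases "t \<in> {0..T}") (auto simp: F_def)
    qed
    also have "\<dots> \<le> norm (M * (?h x * ?g t))"
      by (simp add: abs_mult mult_right_mono)
    finally show "norm (F x t) \<le> norm (M * (?h x * ?g t))" by simp
  qed
  have "(\<integral>t. (\<integral>x. F x t \<partial>lborel) \<partial>lborel) = (\<integral>x. (\<integral>t. F x t \<partial>lborel) \<partial>lborel)"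
    by (rule lborel_pair.Fubini_integral[OF Fi])
  moreover have "(\<integral>x. F x t \<partial>lborel) = indicator {0..T} t *\<^sub>R (lconv k h t * g t)" for t
  proof -
    have "F x t = indicator {0..t} x *\<^sub>R (h x * k (t - x)) * (indicator {0..T} t * g t)" for x
      by (auto simp: F_def indicator_def)
    then have "(\<integral>x. F x t \<partial>lborel) = (\<integral>x. indicator {0..t} x *\<^sub>R (h x * k (t - x)) * (indicator {0..T} t * g t) \<partial>lborel)"
      by simp
    also have "\<dots> = (\<integral>x. indicator {0..t} x *\<^sub>R (h x * k (t - x)) \<partial>lborel) * (indicator {0..T} t * g t)"
      by (rule integral_mult_left_zero)
    finally show ?thesis by (simp add: lconv_def set_lebesgue_integral_def)
  qed
  moreover have "(\<integral>t. F x t \<partial>lborel) = indicator {0..T} x *\<^sub>R (h x * rconv k T g x)" for x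
  proof -
    have "F x t = (indicator {0..T} x * h x) * indicator {x..T} t *\<^sub>R (g t * k (t - x))" for t
      by (auto simp: F_def indicator_def)
    then have "(\<integral>t. F x t \<partial>lborel) = (\<integral>t. (indicator {0..T} x * h x) * indicator {x..T} t *\<^sub>R (g t * k (t - x)) \<partial>lborel)"
      by simp
    also have "\<dots> = (indicator {0..T} x * h x) * (\<integral>t. indicator {x..T} t *\<^sub>R (g t * k (t - x)) \<partial>lborel)"
      by (rule integral_mult_right_zero)
    finally show ?thesis by (simp add: rconv_def set_lebesgue_integral_def)
  qed
  ultimately show ?thesis
    by (simp add: set_lebesgue_integral_def)
qed

section \<open>Reflection of the variable and continuity of the left convolution\<close>

lemma lborel_set_integral_reflect:
  fixes \<phi> :: "real \<Rightarrow> real" and a b c :: real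
  shows "(LINT x:{a..b}|lborel. \<phi> x) = (LINT x:{c-b..c-a}|lborel. \<phi> (c - x))"
proof -
  have "indicator {a..b} (c + - 1 * x) = (indicator {c-b..c-a} x :: real)" for x
    by (auto simp: indicator_def)
  then show ?thesis
    using lborel_integral_real_affine[of "- 1" "\<lambda>x. indicator {a..b} x *\<^sub>R \<phi> x" c]
    by (simp add: set_lebesgue_integral_def)
qed

lemma set_integrable_reflect:
  fixes \<phi> :: "real \<Rightarrow> real" and a b c :: real
  assumes "set_integrable lborel {a..b} \<phi>"
  shows "set_integrable lborel {c-b..c-a} (\<lambda>x. \<phi> (c - x))"
proof -
  have "indicator {a..b} (c + - 1 * x) = (indicator {c-b..c-a} x :: real)" for x
    by (auto simp: indicator_def)
  moreover have "integrable lborel (\<lambda>x. indicator {a..b} (c + - 1 * x) *\<^sub>R \<phi> (c + - 1 * x))"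
    using lborel_integrable_real_affine[of "\<lambda>x. indicator {a..b} x *\<^sub>R \<phi> x" "- 1" c] assms
    by (simp add: set_integrable_def)
  ultimately show ?thesis by (simp add: set_integrable_def)
qed

lemma set_integrable_mult_continuous:
  fixes h G :: "real \<Rightarrow> real"
  assumes h: "set_integrable lborel {a..b} h" and G: "continuous_on {a..b} G"
  shows "set_integrable lborel {a..b} (\<lambda>x. h x * G x)"
proof -
  have "compact (G ` {a..b})"
    using G by (intro compact_continuous_image) auto
  then obtain M where M: "\<And>u. u \<in> {a..b} \<Longrightarrow> \<bar>G u\<bar> \<le> M"
    by (meson bounded_real compact_imp_bounded imageI)
  have "set_borel_measurable borel {a..b} G"
    using G by (intro set_measurable_continuous_on) auto
  then have [measurable]: "(\<lambda>x. indicator {a..b} x *\<^sub>R G x) \<in> borel_measurable borel"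
    by (simp add: set_borel_measurable_def)
  have [measurable]: "(\<lambda>x. indicator {a..b} x *\<^sub>R h x) \<in> borel_measurable borel"
    using h unfolding set_integrable_def by auto
  \<comment> \<open>Measurability is known only after truncation to the interval, so the product of
    the truncated functions is used.\<close>
  have "(\<lambda>x. (indicator {a..b} x *\<^sub>R h x) * (indicator {a..b} x *\<^sub>R G x)) \<in> borel_measurable borel"
    by measurable
  also have "(\<lambda>x. (indicator {a..b} x *\<^sub>R h x) * (indicator {a..b} x *\<^sub>R G x)) =
      (\<lambda>x. indicator {a..b} x *\<^sub>R (h x * G x))"
    by (auto simp: indicator_def)
  finally have m: "set_borel_measurable lborel {a..b} (\<lambda>x. h x * G x)"
    by (simp add: set_borel_measurable_def)
  have "\<bar>h x * G x\<bar> \<le> \<bar>M * h x\<bar>" if "x \<in> {a..b}" for x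
  proof -
    have "\<bar>h x * G x\<bar> \<le> \<bar>h x\<bar> * \<bar>M\<bar>"
      unfolding abs_mult using M[OF that] by (intro mult_left_mono) auto
    then show ?thesis by (simp add: abs_mult mult.commute)
  qed
  then show ?thesis
    by (intro set_integrable_bound[OF set_integrable_mult_right[OF h, of M] m]) auto
qed

text \<open>Dominated convergence along sequences: the moving upper limit becomes a cutoff in the
  integrand, and a bound for \<open>k\<close> times \<open>h\<close> is the majorant.\<close>

lemma continuous_on_lconv:
  assumes k: "continuous_on UNIV k" and h: "set_integrable lborel {0..b} h"
  shows "continuous_on {0..b} (lconv k h)"
  unfolding continuous_on_sequentially
proof (intro allI impI ballI, elim conjE, unfold o_def)
  fix s t assume t: "t \<in> {0..b}" and s: "\<forall>n. s n \<in> {0..b}" and lim: "s \<longlonglongrightarrow> t"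
  let ?h = "\<lambda>x. indicator {0..b} x *\<^sub>R h x"
  have hi: "integrable lborel ?h"
    using h by (auto simp: set_integrable_def)
  have [measurable]: "?h \<in> borel_measurable borel"
    using hi by auto
  have [measurable]: "k \<in> borel_measurable borel" using k by (rule borel_measurable_continuous_onI)
  have "compact (k ` {-b..b})"
    using k by (intro compact_continuous_image) (auto intro: continuous_on_subset)
  then obtain M where M: "\<And>u. u \<in> {-b..b} \<Longrightarrow> \<bar>k u\<bar> \<le> M"
    by (meson bounded_real compact_imp_bounded imageI)
  define F where "F u x = ?h x * (if x \<le> u then k (u - x) else 0)" for u x
  have Fm: "F u \<in> borel_measurable lborel" for u
    unfolding F_def by measurable
  have eq: "lconv k h u = integral\<^sup>L lborel (F u)" if "u \<in> {0..b}" for u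
    unfolding lconv_def set_lebesgue_integral_def F_def
    by (rule arg_cong[of _ _ "integral\<^sup>L lborel"]) (use that in \<open>auto simp: indicator_def fun_eq_iff\<close>)
  have bound: "norm (F u x) \<le> \<bar>M\<bar> * norm (?h x)" if "u \<in> {0..b}" for u x
  proof (cases "x \<in> {0..b} \<and> x \<le> u")
    case True
    then have "\<bar>k (u - x)\<bar> \<le> M" using that by (intro M) auto
    then have "\<bar>k (u - x)\<bar> \<le> \<bar>M\<bar>" by auto
    then show ?thesis using True
      by (auto simp: F_def abs_mult mult.commute[of "\<bar>M\<bar>"] intro!: mult_left_mono)
  qed (auto simp: F_def)
  have "(\<lambda>n. integral\<^sup>L lborel (F (s n))) \<longlonglongrightarrow> integral\<^sup>L lborel (F t)"
  proof (rule integral_dominated_convergence)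
    show "integrable lborel (\<lambda>x. \<bar>M\<bar> * norm (?h x))" using hi by auto
    show "AE x in lborel. norm (F (s n) x) \<le> \<bar>M\<bar> * norm (?h x)" for n
      using bound s by auto
    show "AE x in lborel. (\<lambda>n. F (s n) x) \<longlonglongrightarrow> F t x"
      \<comment> \<open>At \<open>x = t\<close> the cutoff jumps, so pointwise convergence may fail
        there; the point is a null set.\<close>
      using AE_lborel_singleton[of t]
    proof eventually_elim
      case (elim x)
      show ?case
      proof (cases "x < t")
        case True
        have "eventually (\<lambda>n. x < s n) sequentially" using order_tendstoD(1)[OF lim True] .
        then have ev: "eventually (\<lambda>n. ?h x * k (s n - x) = F (s n) x) sequentially"
          by eventually_elim (auto simp: F_def)
        have "isCont k (t - x)" using k by (simp add: continuous_on_eq_continuous_at)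
        then have "(\<lambda>n. ?h x * k (s n - x)) \<longlonglongrightarrow> ?h x * k (t - x)"
          by (intro tendsto_intros isCont_tendsto_compose[of _ k] lim)
        then have "(\<lambda>n. F (s n) x) \<longlonglongrightarrow> ?h x * k (t - x)"
          using ev by (rule Lim_transform_eventually)
        then show ?thesis using True by (simp add: F_def)
      next
        case False
        with elim have "t < x" by simp
        have "eventually (\<lambda>n. s n < x) sequentially" using order_tendstoD(2)[OF lim \<open>t < x\<close>] .
        then have "eventually (\<lambda>n. 0 = F (s n) x) sequentially"
          by eventually_elim (auto simp: F_def)
        then have "(\<lambda>n. F (s n) x) \<longlonglongrightarrow> 0"
          by (rule Lim_transform_eventually[OF tendsto_const])
        then show ?thesis using \<open>t < x\<close> by (simp add: F_def)
      qed
    qed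
  qed (rule Fm)+
  then show "(\<lambda>n. lconv k h (s n)) \<longlonglongrightarrow> lconv k h t"
    using s t by (simp add: eq)
qed

text \<open>Absolute continuity on \<open>{0..b}\<close> in integrated form. No pointwise derivative
  enters, so any integrable representative of a weak derivative can serve as
  \<open>h\<close>.\<close>

definition antideriv_on :: "real \<Rightarrow> (real \<Rightarrow> real) \<Rightarrow> (real \<Rightarrow> real) \<Rightarrow> bool" where
  "antideriv_on b f h \<longleftrightarrow> set_integrable lborel {0..b} h \<and>
     (\<forall>t\<in>{0..b}. f t = f 0 + (LINT x:{0..t}|lborel. h x))"

lemma antideriv_onD:
  assumes "antideriv_on b f h"
  shows "set_integrable lborel {0..b} h"
    and "t \<in> {0..b} \<Longrightarrow> (LINT x:{0..t}|lborel. h x) = f t - f 0"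
proof -
  show "set_integrable lborel {0..b} h" using assms by (simp add: antideriv_on_def)
  assume t: "t \<in> {0..b}"
  have "f t = f 0 + (LINT x:{0..t}|lborel. h x)"
    using assms t unfolding antideriv_on_def by blast
  then show "(LINT x:{0..t}|lborel. h x) = f t - f 0" by linarith
qed

lemma antideriv_on_continuous:
  assumes "antideriv_on b f h"
  shows "continuous_on {0..b} f"
proof -
  have "continuous_on {0..b} (\<lambda>t. f 0 + lconv (\<lambda>_. 1) h t)"
    using assms by (intro continuous_intros continuous_on_lconv) (auto simp: antideriv_on_def)
  then show ?thesis
    by (rule continuous_on_eq) (simp add: lconv_def antideriv_onD[OF assms])
qed

text \<open>Fubini with the constant kernel 1 takes the place of the product rule, as
  \<open>h\<close> is merely integrable. With \<open>f = f 0 + J\<close>, the integral of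
  \<open>J * P\<close> turns into that of \<open>h x\<close> times the integral of \<open>P\<close>
  over \<open>{x..b}\<close>, which is \<open>G b - G x\<close>.\<close>

lemma integration_by_parts_C1:
  assumes b: "0 \<le> b" and f: "antideriv_on b f h" and P: "continuous_on {0..b} P"
    and G: "\<And>x. x \<in> {0..b} \<Longrightarrow> (G has_vector_derivative P x) (at x within {0..b})"
  shows "(LINT x:{0..b}|lborel. h x * G x) + (LINT x:{0..b}|lborel. f x * P x) = f b * G b - f 0 * G 0"
proof -
  let ?J = "lconv (\<lambda>_. 1) h"
  have h: "set_integrable lborel {0..b} h" using f by (simp add: antideriv_on_def)
  have Pi: "set_integrable lborel {0..b} P" using P by (rule borel_integrable_atLeastAtMost')
  have Gc: "continuous_on {0..b} G"
    using G by (meson continuous_on_eq_continuous_within has_vector_derivative_continuous)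
  have hG: "set_integrable lborel {0..b} (\<lambda>x. h x * G x)"
    using h Gc by (rule set_integrable_mult_continuous)
  have JP: "set_integrable lborel {0..b} (\<lambda>x. ?J x * P x)"
    by (rule borel_integrable_atLeastAtMost'[OF continuous_on_mult[OF continuous_on_lconv[OF _ h] P]]) simp
  have FTC: "(LINT t:{x..b}|lborel. P t) = G b - G x" if "x \<in> {0..b}" for x
    unfolding set_lebesgue_integral_def
    using that by (intro integral_FTC_atLeastAtMost continuous_on_subset[OF P]
        has_vector_derivative_within_subset[OF G]) auto
  have "(LINT x:{0..b}|lborel. f x * P x) = (LINT x:{0..b}|lborel. f 0 * P x + ?J x * P x)"
    by (intro set_lebesgue_integral_cong) (simp_all add: antideriv_onD[OF f] lconv_def algebra_simps)
  also have "\<dots> = f 0 * (LINT x:{0..b}|lborel. P x) + (LINT x:{0..b}|lborel. ?J x * P x)"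
    using Pi JP by simp
  also have "(LINT x:{0..b}|lborel. ?J x * P x) = (LINT x:{0..b}|lborel. h x * rconv (\<lambda>_. 1) b P x)"
    using h Pi by (intro triangle_Fubini) auto
  also have "\<dots> = (LINT x:{0..b}|lborel. G b * h x - h x * G x)"
    by (intro set_lebesgue_integral_cong) (auto simp: FTC rconv_def algebra_simps)
  also have "\<dots> = G b * (LINT x:{0..b}|lborel. h x) - (LINT x:{0..b}|lborel. h x * G x)"
    using h hG by simp
  also have "(LINT x:{0..b}|lborel. P x) = G b - G 0" using FTC[of 0] b by simp
  also have "(LINT x:{0..b}|lborel. h x) = f b - f 0" using b by (simp add: antideriv_onD[OF f])
  finally show ?thesis by (simp add: algebra_simps)
qed

text \<open>The formal rule that \<open>g * k\<close> has derivative \<open>g 0 * k + h * k\<close>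
  (convolution in the first and last product), in integrated form. Substituting
  \<open>g = g 0 + 1 * h\<close> leaves an instance of associativity and commutativity of
  convolution, obtained from two uses of Fubini with a reflection between them.\<close>

lemma lconv_eq_integral:
  assumes k: "continuous_on UNIV k" and g: "antideriv_on b g h" and t: "t \<in> {0..b}"
  shows "lconv k g t = (LINT s:{0..t}|lborel. g 0 * k s + lconv k h s)"
proof -
  let ?J = "lconv (\<lambda>_. 1) h"
  have h: "set_integrable lborel {0..t} h"
    using g t by (auto simp: antideriv_on_def intro: set_integrable_subset)
  have kc: "continuous_on {0..t} (\<lambda>x. k (t - x))" "continuous_on {0..t} k"
    by (intro continuous_on_compose2[OF k] continuous_intros) (auto intro: continuous_on_subset[OF k])
  have ki: "set_integrable lborel {0..t} (\<lambda>x. k (t - x))" "set_integrable lborel {0..t} k"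
    using kc by (auto intro: borel_integrable_atLeastAtMost')
  have Jk: "set_integrable lborel {0..t} (\<lambda>x. ?J x * k (t - x))"
    by (rule borel_integrable_atLeastAtMost'[OF continuous_on_mult[OF continuous_on_lconv[OF _ h] kc(1)]]) simp
  have hk: "set_integrable lborel {0..t} (lconv k h)"
    by (rule borel_integrable_atLeastAtMost'[OF continuous_on_lconv[OF k h]])
  have "lconv k g t = (LINT x:{0..t}|lborel. g 0 * k (t - x) + ?J x * k (t - x))"
    unfolding lconv_def[of k g]
    using t by (intro set_lebesgue_integral_cong) (auto simp: antideriv_onD[OF g] lconv_def algebra_simps)
  also have "\<dots> = g 0 * (LINT x:{0..t}|lborel. k (t - x)) + (LINT x:{0..t}|lborel. ?J x * k (t - x))"
    using ki Jk by simp
  also have "(LINT x:{0..t}|lborel. k (t - x)) = (LINT x:{0..t}|lborel. k x)"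
    using lborel_set_integral_reflect[of 0 t k t] by simp
  also have "(LINT x:{0..t}|lborel. ?J x * k (t - x)) =
      (LINT x:{0..t}|lborel. h x * rconv (\<lambda>_. 1) t (\<lambda>x. k (t - x)) x)"
    using h ki by (intro triangle_Fubini) auto
  also have "\<dots> = (LINT x:{0..t}|lborel. h x * rconv k t (\<lambda>_. 1) x)"
  proof (intro set_lebesgue_integral_cong ballI allI impI)
    fix x
    show "h x * rconv (\<lambda>_. 1) t (\<lambda>x. k (t - x)) x = h x * rconv k t (\<lambda>_. 1) x"
      \<comment> \<open>Replacing \<open>s\<close> by \<open>t + x - s\<close> maps
        \<open>{x..t}\<close> onto itself and turns \<open>k (t - s)\<close> into
        \<open>k (s - x)\<close>.\<close>
      using lborel_set_integral_reflect[of x t "\<lambda>s. k (t - s)" "t + x"] by (simp add: rconv_def)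
  qed simp
  also have "\<dots> = (LINT x:{0..t}|lborel. lconv k h x * 1)"
    by (rule triangle_Fubini[symmetric, OF k h]) (simp add: borel_integrable_atLeastAtMost')
  finally show ?thesis using ki hk by simp
qed

text \<open>The integrand of the preceding formula is continuous, so the fundamental theorem applies
  although \<open>g\<close> itself need not be differentiable.\<close>

lemma lconv_C1:
  assumes k: "continuous_on UNIV k" and g: "antideriv_on b g h"
  obtains P where "continuous_on {0..b} P"
    "\<And>t. t \<in> {0..b} \<Longrightarrow> (lconv k g has_vector_derivative P t) (at t within {0..b})"
proof
  let ?P = "\<lambda>s. g 0 * k s + lconv k h s"
  show P: "continuous_on {0..b} ?P"
    using k g by (intro continuous_intros continuous_on_lconv) (auto simp: antideriv_on_def intro: continuous_on_subset)
  fix t assume t: "t \<in> {0..b}"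
  have "((\<lambda>u. integral {0..u} ?P) has_vector_derivative ?P t) (at t within {0..b})"
    using P t by (rule integral_has_vector_derivative)
  then show "(lconv k g has_vector_derivative ?P t) (at t within {0..b})"
  proof (rule has_vector_derivative_transform[OF t, rotated])
    fix u assume u: "u \<in> {0..b}"
    have "set_integrable lborel {0..u} ?P"
      using P u by (intro borel_integrable_atLeastAtMost') (auto intro: continuous_on_subset)
    then show "lconv k g u = integral {0..u} ?P"
      unfolding lconv_eq_integral[OF k g u] by (rule set_borel_integral_eq_integral)
  qed
qed

lemma antideriv_on_reflect:
  assumes g: "antideriv_on b g h"
  shows "antideriv_on b (\<lambda>x. g (b - x)) (\<lambda>x. - h (b - x))"
  unfolding antideriv_on_def
proof
  have h: "set_integrable lborel {0..b} h" using g by (simp add: antideriv_on_def)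
  have hr: "set_integrable lborel {0..b} (\<lambda>x. h (b - x))"
    using set_integrable_reflect[OF h, of b] by simp
  then show "set_integrable lborel {0..b} (\<lambda>x. - h (b - x))"
    using set_integrable_mult_right[OF hr, of "-1"] by simp
  show "\<forall>t\<in>{0..b}. g (b - t) = g (b - 0) + (LINT x:{0..t}|lborel. - h (b - x))"
  proof
    fix t assume t: "t \<in> {0..b}"
    have "(LINT x:{0..b}|lborel. h x) = (LINT x:{0..b-t} \<union> {b-t..b}|lborel. h x)"
      using t by (simp add: ivl_disj_un_two_touch)
    also have "\<dots> = (LINT x:{0..b-t}|lborel. h x) + (LINT x:{b-t..b}|lborel. h x)"
    proof (rule set_integral_Un_AE)
      \<comment> \<open>The two closed pieces share only the point \<open>b - t\<close>.\<close>
      show "AE x in lborel. \<not> (x \<in> {0..b - t} \<and> x \<in> {b - t..b})"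
        using AE_lborel_singleton[of "b-t"] by eventually_elim auto
    qed (use t in \<open>auto intro: set_integrable_subset[OF h]\<close>)
    also have "(LINT x:{b-t..b}|lborel. h x) = (LINT x:{0..t}|lborel. h (b - x))"
      using lborel_set_integral_reflect[of "b-t" b h b] by simp
    finally have "(LINT x:{0..t}|lborel. h (b - x)) = (LINT x:{0..b}|lborel. h x) - (LINT x:{0..b-t}|lborel. h x)"
      by simp
    moreover have "set_integrable lborel {0..t} (\<lambda>x. h (b - x))"
      using t by (auto intro: set_integrable_subset[OF hr])
    moreover have "(LINT x:{0..b}|lborel. h x) = g b - g 0" "(LINT x:{0..b-t}|lborel. h x) = g (b - t) - g 0"
      using t by (simp_all add: antideriv_onD[OF g])
    ultimately show "g (b - t) = g (b - 0) + (LINT x:{0..t}|lborel. - h (b - x))"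
      by (simp add: set_integral_uminus)
  qed
qed

text \<open>Reflection exchanges the two end points, so regularity of the right convolution can be
  read off from the left one.\<close>

lemma rconv_eq_lconv: "rconv k b g t = lconv k (\<lambda>x. g (b - x)) (b - t)"
  unfolding rconv_def lconv_def
  using lborel_set_integral_reflect[of t b "\<lambda>x. g x * k (x - t)" b] by (simp add: algebra_simps)

lemma rconv_C1:
  assumes k: "continuous_on UNIV k" and g: "antideriv_on b g h"
  obtains P where "continuous_on {0..b} P"
    "\<And>t. t \<in> {0..b} \<Longrightarrow> (rconv k b g has_vector_derivative P t) (at t within {0..b})"
proof -
  obtain P where P: "continuous_on {0..b} P"
    "\<And>t. t \<in> {0..b} \<Longrightarrow> (lconv k (\<lambda>x. g (b - x)) has_vector_derivative P t) (at t within {0..b})"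
    by (rule lconv_C1[OF k antideriv_on_reflect[OF g]]) (rule that)
  show thesis
  proof
    show "continuous_on {0..b} (\<lambda>t. - P (b - t))"
      by (intro continuous_intros continuous_on_compose2[OF P(1)]) auto
    fix t assume t: "t \<in> {0..b}"
    have rc: "rconv k b g = lconv k (\<lambda>x. g (b - x)) \<circ> (\<lambda>t. b - t)"
      by (simp add: fun_eq_iff rconv_eq_lconv)
    \<comment> \<open>The chain rule asks for the outer derivative relative to the image, and the
      reflection maps the interval onto itself.\<close>
    have im: "(\<lambda>t. b - t) ` {0..b} = {0..b}" by (simp add: image_diff_atLeastAtMost)
    have "((\<lambda>t. b - t) has_vector_derivative (- 1)) (at t within {0..b})"
      by (auto intro!: derivative_eq_intros)
    then have "((lconv k (\<lambda>x. g (b - x)) \<circ> (\<lambda>t. b - t)) has_vector_derivative (- 1) *\<^sub>R P (b - t)) (at t within {0..b})"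
      by (rule vector_diff_chain_within) (use P(2)[of "b - t"] t in \<open>simp add: im\<close>)
    then show "(rconv k b g has_vector_derivative - P (b - t)) (at t within {0..b})"
      using rc by simp
  qed
qed

section \<open>Absolute continuity of $H^1$ functions\<close>

text \<open>\<open>deriv\<close> maps \<open>S\<close> into itself, so by induction every iterated
  derivative stays in \<open>S\<close>; no formula for higher derivatives is needed.\<close>

lemma deriv_closed_imp_smooth:
  assumes "f \<in> S" and S: "\<And>g. g \<in> S \<Longrightarrow> \<exists>g'\<in>S. \<forall>x. (g has_real_derivative g' x) (at x)"
  shows "(deriv ^^ n) f differentiable_on UNIV"
proof -
  have deriv: "deriv g \<in> S" if g: "g \<in> S" for g
  proof -
    obtain g' where g': "g' \<in> S" "\<forall>x. (g has_real_derivative g' x) (at x)"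
      using S[OF g] by blast
    then have "deriv g = g'" by (auto simp: fun_eq_iff intro: DERIV_imp_deriv)
    then show ?thesis using g' by simp
  qed
  have "(deriv ^^ n) f \<in> S"
    by (induction n) (auto simp: assms(1) deriv)
  then obtain g' where "\<forall>x. ((deriv ^^ n) f has_real_derivative g' x) (at x)" using S[of "(deriv ^^ n) f"] by blast
  then show ?thesis
    by (meson differentiable_at_imp_differentiable_on real_differentiable_def)
qed

text \<open>With polynomials \<open>w\<close> and \<open>p\<close> this family is closed under differentiation, which gives
  smoothness without a Leibniz rule for higher derivatives.\<close>

definition bump :: "real poly \<Rightarrow> real poly \<Rightarrow> nat \<Rightarrow> real \<Rightarrow> real" where
  "bump w p m x = (if poly w x > 0 then poly p x / poly w x ^ m * exp (- 1 / poly w x) else 0)"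

text \<open>The exponential beats every power of \<open>1 / w\<close>; a quadratic bound in
  \<open>w\<close> is what the difference quotient at a zero of \<open>w\<close> requires. It comes
  from \<open>y \<le> exp y\<close> at \<open>y = 1 / (n * w)\<close>, raised to the power
  \<open>n = m + 2\<close>.\<close>

lemma exp_minus_inverse_le:
  fixes w :: real
  assumes "w > 0"
  shows "exp (- 1 / w) / w ^ m \<le> real (m + 2) ^ (m + 2) * w\<^sup>2"
proof -
  let ?n = "m + 2"
  have "1 / (real ?n * w) \<le> exp (1 / (real ?n * w))"
    using exp_ge_add_one_self[of "1 / (real ?n * w)"] by linarith
  then have "(1 / (real ?n * w)) ^ ?n \<le> exp (1 / (real ?n * w)) ^ ?n"
    using assms by (intro power_mono) auto
  also have "\<dots> = exp (1 / w)"
    by (subst exp_of_nat_mult[symmetric]) simp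
  finally have "1 \<le> real ?n ^ ?n * w ^ ?n * exp (1 / w)"
    using assms by (simp only: power_divide power_mult_distrib power_one) (simp add: divide_le_eq mult_ac)
  then have "exp (- 1 / w) * 1 \<le> exp (- 1 / w) * (real ?n ^ ?n * w ^ ?n * exp (1 / w))"
    by (intro mult_left_mono) auto
  also have "\<dots> = real ?n ^ ?n * w ^ ?n"
    by (simp add: exp_minus)
  finally have "exp (- 1 / w) \<le> real ?n ^ ?n * w\<^sup>2 * w ^ m"
    by (simp add: power_add power2_eq_square mult_ac)
  then show ?thesis
    using assms by (simp add: divide_le_eq)
qed

text \<open>The numerator left after differentiating \<open>p / w ^ m * exp (- 1 / w)\<close> and
  taking \<open>w ^ (m + 2)\<close> as common denominator.\<close>

definition bump_deriv_coeff :: "real poly \<Rightarrow> real poly \<Rightarrow> nat \<Rightarrow> real poly" where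
  "bump_deriv_coeff w p m = pderiv p * w\<^sup>2 - smult (of_nat m) (p * pderiv w * w) + p * pderiv w"

lemma bump_deriv_identity:
  fixes P P' W W' E :: real
  assumes "W > 0"
  shows "P / W ^ m * (E * (W' / (W * W))) +
      (P' * W ^ m - P * (of_nat m * (W' * W ^ (m - Suc 0)))) / (W ^ m * W ^ m) * E =
      (P' * W\<^sup>2 - of_nat m * (P * W' * W) + P * W') / W ^ (m + 2) * E"
  \<comment> \<open>At \<open>m = 0\<close> the truncated exponent \<open>m - Suc 0\<close> is
    harmless, since its term has coefficient \<open>0\<close>.\<close>
  using assms by (cases m) (simp_all add: field_simps power2_eq_square)

text \<open>Where \<open>w\<close> is positive the usual rules apply. Elsewhere, zeros of
  \<open>w\<close> included, the value is \<open>0\<close> and the flatness estimate forces the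
  difference quotient to \<open>0\<close>.\<close>

lemma DERIV_bump: "(bump w p m has_real_derivative bump w (bump_deriv_coeff w p m) (m + 2) x) (at x)"
proof (cases "poly w x > 0")
  case True
  let ?f = "\<lambda>x. poly p x / poly w x ^ m * exp (- 1 / poly w x)"
  let ?W = "poly w x" and ?E = "exp (- 1 / poly w x)"
  have "((\<lambda>x. poly p x / poly w x ^ m) has_real_derivative
      (poly (pderiv p) x * ?W ^ m - poly p x * (of_nat m * (poly (pderiv w) x * ?W ^ (m - Suc 0)))) /
        (?W ^ m * ?W ^ m)) (at x)"
    using True by (intro DERIV_divide DERIV_power poly_DERIV) simp
  moreover have "((\<lambda>x. exp (- 1 / poly w x)) has_real_derivative
      ?E * (poly (pderiv w) x / (?W * ?W))) (at x)"
    using True DERIV_divide[OF DERIV_const[of "- 1"] poly_DERIV[of w x]]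
    by (intro DERIV_chain2[OF DERIV_exp]) simp
  ultimately have "(?f has_real_derivative
      poly p x / ?W ^ m * (?E * (poly (pderiv w) x / (?W * ?W))) +
      (poly (pderiv p) x * ?W ^ m - poly p x * (of_nat m * (poly (pderiv w) x * ?W ^ (m - Suc 0)))) /
        (?W ^ m * ?W ^ m) * ?E) (at x)"
    by (rule DERIV_mult')
  also have "poly p x / ?W ^ m * (?E * (poly (pderiv w) x / (?W * ?W))) +
      (poly (pderiv p) x * ?W ^ m - poly p x * (of_nat m * (poly (pderiv w) x * ?W ^ (m - Suc 0)))) /
        (?W ^ m * ?W ^ m) * ?E = bump w (bump_deriv_coeff w p m) (m + 2) x"
    unfolding bump_deriv_identity[OF True] using True by (simp add: bump_def bump_deriv_coeff_def)
  finally have "(?f has_real_derivative bump w (bump_deriv_coeff w p m) (m + 2) x) (at x)" .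
  moreover have "open {x. 0 < poly w x}"
    by (intro open_Collect_less continuous_intros)
  ultimately show ?thesis
    by (rule has_field_derivative_transform_within_open) (use True in \<open>auto simp: bump_def\<close>)
next
  case False
  let ?C = "real (m + 2) ^ (m + 2)"
  have "isCont (poly w) x" "isCont (poly p) x" by (rule poly_isCont)+
  then have lim: "(poly w \<longlongrightarrow> poly w x) (at x)" "(poly p \<longlongrightarrow> poly p x) (at x)"
    by (simp_all add: isCont_def)
  have wd: "((\<lambda>y. (poly w y - poly w x) / (y - x)) \<longlongrightarrow> poly (pderiv w) x) (at x)"
    using poly_DERIV[of w x] by (simp add: has_field_derivative_iff)
  \<comment> \<open>Since \<open>poly w x \<le> 0 < poly w y\<close> in the critical case, the
    quadratic bound in \<open>poly w y\<close> is also one in \<open>poly w y - poly w x\<close>.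
    One such factor tends to \<open>0\<close>; the other, divided by \<open>y - x\<close>, tends to
    the derivative of \<open>w\<close>.\<close>
  let ?g = "\<lambda>y. \<bar>poly p y\<bar> * ?C * \<bar>poly w y - poly w x\<bar> * \<bar>(poly w y - poly w x) / (y - x)\<bar>"
  have "(?g \<longlongrightarrow> \<bar>poly p x\<bar> * ?C * \<bar>poly w x - poly w x\<bar> * \<bar>poly (pderiv w) x\<bar>) (at x)"
    by (intro tendsto_mult tendsto_rabs tendsto_diff tendsto_const lim wd)
  then have z: "(?g \<longlongrightarrow> 0) (at x)" by (simp only: diff_self abs_zero mult_zero_right mult_zero_left)
  have "norm ((bump w p m y - bump w p m x) / (y - x)) \<le> ?g y" for y
  proof (cases "poly w y > 0")
    case True
    have "\<bar>bump w p m y\<bar> = \<bar>poly p y\<bar> * (exp (- 1 / poly w y) / poly w y ^ m)"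
      using True by (simp add: bump_def abs_mult)
    also have "\<dots> \<le> \<bar>poly p y\<bar> * (?C * (poly w y)\<^sup>2)"
      by (intro mult_left_mono exp_minus_inverse_le True) auto
    also have "\<dots> \<le> \<bar>poly p y\<bar> * (?C * (\<bar>poly w y - poly w x\<bar>)\<^sup>2)"
      using True False by (intro mult_left_mono power_mono) auto
    finally have "\<bar>bump w p m y\<bar> / \<bar>y - x\<bar> \<le> \<bar>poly p y\<bar> * (?C * (\<bar>poly w y - poly w x\<bar>)\<^sup>2) / \<bar>y - x\<bar>"
      by (rule divide_right_mono) auto
    moreover have "bump w p m x = 0" using False by (simp add: bump_def)
    ultimately show ?thesis
      by (simp only: diff_0_right real_norm_def abs_divide power2_eq_square mult.assoc times_divide_eq_right)
  next
    case F: False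
    with False have "bump w p m y = 0" "bump w p m x = 0" by (simp_all add: bump_def)
    then show ?thesis by (simp only: diff_self div_0 norm_zero) simp
  qed
  then have "((\<lambda>y. (bump w p m y - bump w p m x) / (y - x)) \<longlongrightarrow> 0) (at x)"
    by (intro Lim_null_comparison[OF always_eventually z] allI)
  then show ?thesis using False by (simp add: has_field_derivative_iff bump_def)
qed

text \<open>The classical bump \<open>exp (- 1 / (\<epsilon>\<^sup>2 - x\<^sup>2))\<close> on
  \<open>(-\<epsilon>, \<epsilon>)\<close>, extended by \<open>0\<close>.\<close>

definition centred_bump :: "real \<Rightarrow> real \<Rightarrow> real" where
  "centred_bump \<epsilon> = bump [:\<epsilon>\<^sup>2, 0, -1:] 1 0"

lemma poly_centred: "poly [:\<epsilon>\<^sup>2, 0, -1:] x = \<epsilon>\<^sup>2 - x\<^sup>2" for x \<epsilon> :: real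
  by (simp add: power2_eq_square)

lemma centred_bump_pos: "\<epsilon> > 0 \<Longrightarrow> \<bar>x\<bar> < \<epsilon> \<Longrightarrow> centred_bump \<epsilon> x > 0"
  using power_strict_mono[of "\<bar>x\<bar>" \<epsilon> 2] by (simp add: centred_bump_def bump_def poly_centred del: poly_pCons)

lemma centred_bump_0: "\<epsilon> > 0 \<Longrightarrow> \<bar>x\<bar> \<ge> \<epsilon> \<Longrightarrow> centred_bump \<epsilon> x = 0"
  using power_mono[of \<epsilon> "\<bar>x\<bar>" 2] by (simp add: centred_bump_def bump_def poly_centred del: poly_pCons)

lemma centred_bump_nonneg: "\<epsilon> > 0 \<Longrightarrow> centred_bump \<epsilon> x \<ge> 0"
  using centred_bump_pos[of \<epsilon> x] centred_bump_0[of \<epsilon> x] by (cases "\<bar>x\<bar> < \<epsilon>") auto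

lemma continuous_centred_bump: "continuous_on A (centred_bump \<epsilon>)"
  unfolding centred_bump_def
  using DERIV_bump by (meson DERIV_continuous continuous_at_imp_continuous_on)

lemma centred_bump_antideriv:
  assumes "\<epsilon> > 0"
  obtains \<Psi> M where "\<And>x. (\<Psi> has_real_derivative centred_bump \<epsilon> x) (at x)"
    "\<And>x. x \<le> - \<epsilon> \<Longrightarrow> \<Psi> x = 0" "\<And>x. x \<ge> \<epsilon> \<Longrightarrow> \<Psi> x = M" "M > 0"
proof -
  \<comment> \<open>Starting to the left of the support makes \<open>- \<epsilon>\<close> an
    interior point, so that the derivative is two-sided there. The final constant value is the mass
    of the bump.\<close>
  define \<Psi> where "\<Psi> x = integral {- \<epsilon> - 1..x} (centred_bump \<epsilon>)" for x
  have left: "\<Psi> x = 0" if "x \<le> - \<epsilon>" for x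
  proof -
    have "\<Psi> x = integral {- \<epsilon> - 1..x} (\<lambda>_. 0)"
      unfolding \<Psi>_def using that assms by (intro integral_cong centred_bump_0) auto
    then show ?thesis by simp
  qed
  have D: "(\<Psi> has_real_derivative centred_bump \<epsilon> x) (at x)" for x
  proof (cases "x < - \<epsilon>")
    case True
    have "((\<lambda>_. 0) has_real_derivative 0) (at x)" by simp
    then have "(\<Psi> has_real_derivative 0) (at x)"
      by (rule has_field_derivative_transform_within_open[where S="{..<-\<epsilon>}"]) (use True left in auto)
    then show ?thesis using True assms centred_bump_0[of \<epsilon> x] by simp
  next
    case False
    have "(\<Psi> has_vector_derivative centred_bump \<epsilon> x) (at x within {- \<epsilon> - 1..x + 1})"
      unfolding \<Psi>_def using False
      by (intro integral_has_vector_derivative continuous_centred_bump) auto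
    then show ?thesis
      using False by (simp add: at_within_Icc_at has_real_derivative_iff_has_vector_derivative)
  qed
  have cont: "continuous_on A \<Psi>" for A
    using D by (meson DERIV_continuous continuous_at_imp_continuous_on)
  have right: "\<Psi> x = \<Psi> \<epsilon>" if "x \<ge> \<epsilon>" for x
  proof (cases "x = \<epsilon>")
    case False
    with that have "\<epsilon> < x" by simp
    then show ?thesis
    proof (rule DERIV_isconst_end[OF _ cont])
      fix y assume "\<epsilon> < y"
      then show "(\<Psi> has_real_derivative 0) (at y)"
        using D[of y] assms centred_bump_0[of \<epsilon> y] by simp
    qed
  qed simp
  have "\<Psi> (- \<epsilon>) < \<Psi> \<epsilon>"
  proof (rule DERIV_pos_imp_increasing_open[OF _ _ cont])
    fix y assume "- \<epsilon> < y" "y < \<epsilon>"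
    then have "centred_bump \<epsilon> y > 0" using assms by (intro centred_bump_pos) auto
    then show "\<exists>z. (\<Psi> has_real_derivative z) (at y) \<and> z > 0" using D by blast
  qed (use assms in simp)
  then have "\<Psi> \<epsilon> > 0" using left[of "- \<epsilon>"] by simp
  with D left right show thesis by (rule that)
qed


text \<open>The difference of two translates of the antiderivative has compact support, because both
  bumps have the same mass.\<close>

lemma translated_antideriv_test_function:
  assumes \<epsilon>: "\<epsilon> > 0"
    and \<Psi>: "\<And>x. (\<Psi> has_real_derivative centred_bump \<epsilon> x) (at x)"
      "\<And>x. x \<le> - \<epsilon> \<Longrightarrow> \<Psi> x = 0" "\<And>x. x \<ge> \<epsilon> \<Longrightarrow> \<Psi> x = M"
    and c: "\<epsilon> < c" "c < b - \<epsilon>" and d: "\<epsilon> < d" "d < b - \<epsilon>"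
  shows "(\<lambda>x. \<Psi> (x - c) - \<Psi> (x - d)) \<in> test_functions b" (is "?\<phi> \<in> _")
    and "deriv (\<lambda>x. \<Psi> (x - c) - \<Psi> (x - d)) = (\<lambda>x. centred_bump \<epsilon> (x - c) - centred_bump \<epsilon> (x - d))"
proof -
  let ?w = "[:\<epsilon>\<^sup>2, 0, -1:]"
  \<comment> \<open>The antiderivative is adjoined to the bumps over \<open>?w\<close>; its
    derivative is one of them. Differences of translates inherit the closure under
    differentiation.\<close>
  define S0 where "S0 = insert \<Psi> (range (\<lambda>(p, m). bump ?w p m))"
  define S where "S = (\<lambda>u x. u (x - c) - u (x - d) :: real) ` S0"
  have D0: "\<exists>u'\<in>S0. \<forall>x. (u has_real_derivative u' x) (at x)" if "u \<in> S0" for u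
    using that unfolding S0_def
  proof (elim insertE imageE)
    assume "u = \<Psi>"
    then show "\<exists>u'\<in>insert \<Psi> (range (\<lambda>(p, m). bump ?w p m)). \<forall>x. (u has_real_derivative u' x) (at x)"
      using \<Psi>(1) by (intro bexI[of _ "centred_bump \<epsilon>"]) (auto simp: centred_bump_def)
  next
    fix z assume "u = (case z of (p, m) \<Rightarrow> bump ?w p m)"
    moreover obtain p m where "z = (p, m)" by fastforce
    ultimately have "u = bump ?w p m" by simp
    then show "\<exists>u'\<in>insert \<Psi> (range (\<lambda>(p, m). bump ?w p m)). \<forall>x. (u has_real_derivative u' x) (at x)"
      using DERIV_bump by (intro bexI[of _ "bump ?w (bump_deriv_coeff ?w p m) (m + 2)"]) auto
  qed
  have Ds: "((\<lambda>x. u (x - c) - u (x - d)) has_real_derivative u' (x - c) - u' (x - d)) (at x)"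
    if "\<forall>x. (u has_real_derivative u' x) (at x)" for u u' x
    using that DERIV_shift[of u _ x "- c"] DERIV_shift[of u _ x "- d"] by (auto intro!: DERIV_diff)
  show "deriv ?\<phi> = (\<lambda>x. centred_bump \<epsilon> (x - c) - centred_bump \<epsilon> (x - d))"
    using Ds[of \<Psi>] \<Psi>(1) by (auto simp: fun_eq_iff intro: DERIV_imp_deriv)
  have smooth: "(deriv ^^ n) ?\<phi> differentiable_on UNIV" for n
  proof (rule deriv_closed_imp_smooth)
    show "?\<phi> \<in> S" by (auto simp: S_def S0_def)
    fix g assume "g \<in> S"
    then obtain u where u: "u \<in> S0" "g = (\<lambda>x. u (x - c) - u (x - d))" by (auto simp: S_def)
    obtain u' where u': "u' \<in> S0" "\<forall>x. (u has_real_derivative u' x) (at x)" using D0[OF u(1)] by blast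
    then show "\<exists>g'\<in>S. \<forall>x. (g has_real_derivative g' x) (at x)"
      using Ds[OF u'(2)] by (intro bexI[of _ "\<lambda>x. u' (x - c) - u' (x - d)"]) (auto simp: S_def u(2))
  qed
  have zero: "?\<phi> x = 0" if "x \<notin> {min c d - \<epsilon>..max c d + \<epsilon>}" for x
    using that \<Psi>(2)[of "x - c"] \<Psi>(2)[of "x - d"] \<Psi>(3)[of "x - c"] \<Psi>(3)[of "x - d"]
    by (cases "x < min c d - \<epsilon>") auto
  have sub: "closure {x. ?\<phi> x \<noteq> 0} \<subseteq> {min c d - \<epsilon>..max c d + \<epsilon>}"
    by (rule closure_minimal) (use zero in blast)+
  then have "compact (closure {x. ?\<phi> x \<noteq> 0})"
    by (meson bounded_closed_interval bounded_subset closed_closure compact_eq_bounded_closed)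
  moreover have "{min c d - \<epsilon>..max c d + \<epsilon>} \<subseteq> {0<..<b}" using c d by auto
  ultimately show "?\<phi> \<in> test_functions b"
    using smooth sub unfolding test_functions_def by blast
qed

text \<open>The translated bump is nonnegative with mass \<open>M\<close>, so the error is the
  integral of \<open>u x - u c\<close> against it, and \<open>u x - u c\<close> is at most
  \<open>\<delta>\<close> in absolute value on its support.\<close>

lemma bump_average:
  assumes \<epsilon>: "\<epsilon> > 0"
    and \<Psi>: "\<And>x. (\<Psi> has_real_derivative centred_bump \<epsilon> x) (at x)"
      "\<And>x. x \<le> - \<epsilon> \<Longrightarrow> \<Psi> x = 0" "\<And>x. x \<ge> \<epsilon> \<Longrightarrow> \<Psi> x = M"
    and c: "\<epsilon> < c" "c < b - \<epsilon>" and u: "continuous_on {0..b} u"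
    and close: "\<And>x. \<bar>x - c\<bar> < \<epsilon> \<Longrightarrow> \<bar>u x - u c\<bar> \<le> \<delta>"
  shows "\<bar>(LINT x:{0..b}|lborel. u x * centred_bump \<epsilon> (x - c)) - u c * M\<bar> \<le> \<delta> * M"
proof -
  let ?\<eta> = "\<lambda>x. centred_bump \<epsilon> (x - c)"
  have \<eta>: "continuous_on {0..b} ?\<eta>"
    by (intro continuous_on_compose2[OF continuous_centred_bump[of UNIV]] continuous_intros) auto
  have i1: "set_integrable lborel {0..b} ?\<eta>"
    using \<eta> by (rule borel_integrable_atLeastAtMost')
  have i2: "set_integrable lborel {0..b} (\<lambda>x. u x * ?\<eta> x)"
    using \<eta> u by (intro borel_integrable_atLeastAtMost' continuous_intros)
  have i3: "set_integrable lborel {0..b} (\<lambda>x. (u x - u c) * ?\<eta> x)"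
    using \<eta> u by (intro borel_integrable_atLeastAtMost' continuous_intros)
  have "(LINT x:{0..b}|lborel. ?\<eta> x) = \<Psi> (b - c) - \<Psi> (0 - c)"
    unfolding set_lebesgue_integral_def
  proof (rule integral_FTC_atLeastAtMost[OF _ _ \<eta>])
    show "0 \<le> b" using c \<epsilon> by simp
    fix x
    have "((\<lambda>x. \<Psi> (x - c)) has_real_derivative ?\<eta> x) (at x)"
      using DERIV_shift[of \<Psi> "?\<eta> x" x "- c"] \<Psi>(1)[of "x - c"] by simp
    then show "((\<lambda>x. \<Psi> (x - c)) has_vector_derivative ?\<eta> x) (at x within {0..b})"
      by (simp add: has_real_derivative_iff_has_vector_derivative has_vector_derivative_at_within)
  qed
  \<comment> \<open>By the conditions on \<open>c\<close> the whole support lies in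
    \<open>{0..b}\<close>, so no mass is lost.\<close>
  then have mass: "(LINT x:{0..b}|lborel. ?\<eta> x) = M"
    using \<Psi>(2)[of "- c"] \<Psi>(3)[of "b - c"] c by simp
  have "(LINT x:{0..b}|lborel. u x * ?\<eta> x) - u c * M = (LINT x:{0..b}|lborel. u x * ?\<eta> x - u c * ?\<eta> x)"
    using i1 i2 mass by simp
  also have "\<dots> = (LINT x:{0..b}|lborel. (u x - u c) * ?\<eta> x)"
    by (simp add: algebra_simps)
  finally have "\<bar>(LINT x:{0..b}|lborel. u x * ?\<eta> x) - u c * M\<bar> \<le> (LINT x:{0..b}|lborel. \<bar>(u x - u c) * ?\<eta> x\<bar>)"
    using set_integral_norm_bound[OF i3] by simp
  also have "\<dots> \<le> (LINT x:{0..b}|lborel. \<delta> * ?\<eta> x)"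
  proof (rule set_integral_mono)
    fix x
    show "\<bar>(u x - u c) * ?\<eta> x\<bar> \<le> \<delta> * ?\<eta> x"
      using close[of x] centred_bump_nonneg[OF \<epsilon>, of "x - c"] centred_bump_0[OF \<epsilon>, of "x - c"]
      by (cases "\<bar>x - c\<bar> < \<epsilon>") (auto simp: abs_mult intro!: mult_right_mono)
  qed (use i1 set_integrable_abs[OF i3] in auto)
  also have "\<dots> = \<delta> * M" using mass by simp
  finally show ?thesis .
qed

text \<open>Testing with the antiderivative of the difference of two equal bumps, centred at
  \<open>c\<close> and at \<open>d\<close>, shows that the bump averages of \<open>u\<close> at the
  two points agree. For narrow bumps they are close to \<open>u c * M\<close> and
  \<open>u d * M\<close>.\<close>

lemma du_Bois_Reymond:
  assumes u: "continuous_on {0..b} u"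
    and 0: "\<And>\<phi>. \<phi> \<in> test_functions b \<Longrightarrow> (LINT x:{0..b}|lborel. u x * deriv \<phi> x) = 0"
    and c: "c \<in> {0<..<b}" and d: "d \<in> {0<..<b}"
  shows "u c = u d"
proof -
  have "\<bar>u c - u d\<bar> \<le> e" if "e > 0" for e
  proof -
    define \<delta> where "\<delta> = e / 2"
    have \<delta>: "\<delta> > 0" using that by (simp add: \<delta>_def)
    have nbh: "\<exists>r>0. r < z \<and> z < b - r \<and> (\<forall>x. \<bar>x - z\<bar> < r \<longrightarrow> \<bar>u x - u z\<bar> \<le> \<delta>)" if z: "z \<in> {0<..<b}" for z
    proof -
      have "isCont u z" using u z by (intro continuous_on_interior[OF u]) simp
      then obtain s where s: "s > 0" "\<And>x. \<bar>x - z\<bar> < s \<Longrightarrow> \<bar>u x - u z\<bar> < \<delta>"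
        using \<delta> unfolding continuous_at_eps_delta dist_real_def by blast
      then show ?thesis using z
        \<comment> \<open>Halving makes both end point inequalities strict.\<close>
        by (intro exI[of _ "min s (min z (b - z)) / 2"]) (auto simp: min_def less_imp_le field_simps)
    qed
    obtain r where r: "r > 0" "r < c" "c < b - r" "\<And>x. \<bar>x - c\<bar> < r \<Longrightarrow> \<bar>u x - u c\<bar> \<le> \<delta>"
      using nbh[OF c] by blast
    obtain s where s: "s > 0" "s < d" "d < b - s" "\<And>x. \<bar>x - d\<bar> < s \<Longrightarrow> \<bar>u x - u d\<bar> \<le> \<delta>"
      using nbh[OF d] by blast
    \<comment> \<open>A common width gives both bumps the same mass \<open>M\<close>.\<close>
    define \<epsilon> where "\<epsilon> = min r s"
    have \<epsilon>: "\<epsilon> > 0" "\<epsilon> \<le> r" "\<epsilon> \<le> s" using r s by (auto simp: \<epsilon>_def)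
    obtain \<Psi> M where \<Psi>: "\<And>x. (\<Psi> has_real_derivative centred_bump \<epsilon> x) (at x)"
        "\<And>x. x \<le> - \<epsilon> \<Longrightarrow> \<Psi> x = 0" "\<And>x. x \<ge> \<epsilon> \<Longrightarrow> \<Psi> x = M" and M: "M > 0"
      by (rule centred_bump_antideriv[OF \<epsilon>(1)]) (rule that)
    let ?I = "\<lambda>z. LINT x:{0..b}|lborel. u x * centred_bump \<epsilon> (x - z)"
    have int: "set_integrable lborel {0..b} (\<lambda>x. u x * centred_bump \<epsilon> (x - z))" for z
      by (intro borel_integrable_atLeastAtMost' continuous_intros u
          continuous_on_compose2[OF continuous_centred_bump[of UNIV]]) auto
    have test: "(\<lambda>x. \<Psi> (x - c) - \<Psi> (x - d)) \<in> test_functions b"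
       "deriv (\<lambda>x. \<Psi> (x - c) - \<Psi> (x - d)) = (\<lambda>x. centred_bump \<epsilon> (x - c) - centred_bump \<epsilon> (x - d))"
      using translated_antideriv_test_function[OF \<epsilon>(1) \<Psi>, of c b d] r s \<epsilon> by auto
    have "?I c - ?I d = (LINT x:{0..b}|lborel. u x * centred_bump \<epsilon> (x - c) - u x * centred_bump \<epsilon> (x - d))"
      using int by simp
    also have "\<dots> = 0"
      using 0[OF test(1)] by (simp add: test(2) algebra_simps)
    finally have "?I c = ?I d" by simp
    moreover have "\<bar>?I c - u c * M\<bar> \<le> \<delta> * M"
      using r \<epsilon> by (intro bump_average[OF \<epsilon>(1) \<Psi> _ _ u]) auto
    moreover have "\<bar>?I d - u d * M\<bar> \<le> \<delta> * M"
      using s \<epsilon> by (intro bump_average[OF \<epsilon>(1) \<Psi> _ _ u]) auto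
    ultimately have "\<bar>u c * M - u d * M\<bar> \<le> 2 * (\<delta> * M)" by linarith
    then have "\<bar>u c - u d\<bar> * M \<le> e * M"
      using M by (simp add: \<delta>_def abs_mult flip: left_diff_distrib)
    then show ?thesis using M by simp
  qed
  then have "\<bar>u c - u d\<bar> \<le> 0" using field_le_epsilon[of "\<bar>u c - u d\<bar>" 0] by simp
  then show ?thesis by simp
qed

section \<open>Recovering an \<open>H1\<close> function from its weak derivative\<close>

lemma set_integrable_open_closed_interval:
  fixes f :: "real \<Rightarrow> real"
  shows "set_integrable lborel {0<..<b} f \<longleftrightarrow> set_integrable lborel {0..b} f"
  by (rule set_integrable_discrete_difference[where X="{0, b}"]) auto

lemma set_integral_open_closed_interval:
  fixes f :: "real \<Rightarrow> real"
  shows "(LINT x:{0<..<b}|lborel. f x) = (LINT x:{0..b}|lborel. f x)"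
  by (rule set_integral_discrete_difference[where X="{0, b}"]) auto

text \<open>On a bounded interval \<open>1 + (h x)\<^sup>2\<close> is an integrable majorant of
  \<open>\<bar>h x\<bar>\<close>.\<close>

lemma L2_imp_set_integrable:
  assumes "h \<in> L2 b"
  shows "set_integrable lborel {0..b} h"
proof -
  have m: "set_borel_measurable lborel {0<..<b} h" and i: "set_integrable lborel {0<..<b} (\<lambda>x. (h x)\<^sup>2)"
    using assms by (auto simp: L2_def)
  have "set_integrable lborel {0<..<b} (\<lambda>_. 1 :: real)"
    unfolding set_integrable_open_closed_interval by (rule borel_integrable_atLeastAtMost') simp
  then have s: "set_integrable lborel {0<..<b} (\<lambda>x. 1 + (h x)\<^sup>2)"
    using i by (rule set_integral_add)
  have "norm (h x) \<le> norm (1 + (h x)\<^sup>2)" for x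
  proof -
    have "0 \<le> (\<bar>h x\<bar> - 1)\<^sup>2" by simp
    also have "\<dots> = (h x)\<^sup>2 - 2 * \<bar>h x\<bar> + 1" by (simp add: power2_diff)
    finally show ?thesis by simp
  qed
  then have "set_integrable lborel {0<..<b} h"
    by (intro set_integrable_bound[OF s m] AE_I2 impI)
  then show ?thesis by (simp add: set_integrable_open_closed_interval)
qed

lemma H1_weak_deriv:
  assumes "f \<in> H1 b"
  shows "weak_deriv b f \<in> L2 b" "has_weak_deriv b f (weak_deriv b f)"
proof -
  have "\<exists>df. df \<in> L2 b \<and> has_weak_deriv b f df" using assms by (auto simp: H1_def)
  then have "weak_deriv b f \<in> L2 b \<and> has_weak_deriv b f (weak_deriv b f)"
    unfolding weak_deriv_def by (rule someI_ex)
  then show "weak_deriv b f \<in> L2 b" "has_weak_deriv b f (weak_deriv b f)" by auto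
qed

lemma test_functionD:
  assumes "\<phi> \<in> test_functions b"
  shows "(\<phi> has_real_derivative deriv \<phi> x) (at x)" "continuous_on A (deriv \<phi>)" "\<phi> 0 = 0" "\<phi> b = 0"
proof -
  have d: "(deriv ^^ n) \<phi> differentiable_on UNIV" for n
    using assms by (auto simp: test_functions_def)
  from d[of 0] show "(\<phi> has_real_derivative deriv \<phi> x) (at x)"
    by (simp add: differentiable_on_def DERIV_deriv_iff_real_differentiable)
  from d[of 1] show "continuous_on A (deriv \<phi>)"
    using continuous_on_subset[OF differentiable_imp_continuous_on subset_UNIV] by simp
  have "{x. \<phi> x \<noteq> 0} \<subseteq> closure {x. \<phi> x \<noteq> 0}" by (rule closure_subset)
  also have "\<dots> \<subseteq> {0<..<b}" using assms by (simp add: test_functions_def)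
  finally have "{x. \<phi> x \<noteq> 0} \<subseteq> {0<..<b}" .
  then show "\<phi> 0 = 0" "\<phi> b = 0" by auto
qed

text \<open>The indefinite integral of the weak derivative has the same weak derivative as
  \<open>f\<close>. By the du Bois-Reymond lemma the difference is constant on the open interval,
  and continuity carries this to the end points.\<close>

lemma H1_antideriv_on:
  assumes b: "b > 0" and f: "f \<in> H1 b"
  shows "antideriv_on b f (weak_deriv b f)"
proof -
  let ?h = "weak_deriv b f" and ?J = "\<lambda>t. LINT x:{0..t}|lborel. weak_deriv b f x"
  have h: "set_integrable lborel {0..b} ?h"
    using H1_weak_deriv(1)[OF f] by (rule L2_imp_set_integrable)
  have J0: "?J 0 = 0"
    using set_integral_discrete_difference[of "{0}" "{0..0}" "{}" lborel ?h]
    by (simp add: set_lebesgue_integral_def)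
  then have J: "antideriv_on b ?J ?h" unfolding antideriv_on_def using h by simp
  have fc: "continuous_on {0..b} f" using f by (simp add: H1_def)
  have Jc: "continuous_on {0..b} ?J" using J by (rule antideriv_on_continuous)
  let ?u = "\<lambda>x. f x - ?J x"
  have uc: "continuous_on {0..b} ?u" using fc Jc by (rule continuous_on_diff)
  have orth: "(LINT x:{0..b}|lborel. ?u x * deriv \<phi> x) = 0" if \<phi>: "\<phi> \<in> test_functions b" for \<phi>
  proof -
    note \<phi>D = test_functionD[OF \<phi>]
    have i: "set_integrable lborel {0..b} (\<lambda>x. f x * deriv \<phi> x)" "set_integrable lborel {0..b} (\<lambda>x. ?J x * deriv \<phi> x)"
      by (intro borel_integrable_atLeastAtMost' continuous_on_mult fc Jc \<phi>D(2))+
    have "(LINT x:{0..b}|lborel. f x * deriv \<phi> x) = - (LINT x:{0..b}|lborel. ?h x * \<phi> x)"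
      using H1_weak_deriv(2)[OF f] \<phi> by (simp add: has_weak_deriv_def set_integral_open_closed_interval)
    \<comment> \<open>The boundary terms disappear because test functions vanish at \<open>0\<close>
      and \<open>b\<close>.\<close>
    moreover have "(LINT x:{0..b}|lborel. ?h x * \<phi> x) + (LINT x:{0..b}|lborel. ?J x * deriv \<phi> x) = ?J b * \<phi> b - ?J 0 * \<phi> 0"
      using b \<phi>D by (intro integration_by_parts_C1[OF _ J])
        (auto simp: has_field_derivative_at_within simp flip: has_real_derivative_iff_has_vector_derivative)
    ultimately have "(LINT x:{0..b}|lborel. f x * deriv \<phi> x) - (LINT x:{0..b}|lborel. ?J x * deriv \<phi> x) = 0"
      using \<phi>D by simp
    then show ?thesis
      using set_integral_diff(2)[OF i] by (simp add: left_diff_distrib)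
  qed
  have mid: "?u x = ?u (b/2)" if "x \<in> {0<..<b}" for x
    using that b by (intro du_Bois_Reymond[OF uc orth]) auto
  have const: "?u x = ?u (b/2)" if x: "x \<in> {0..b}" for x
  proof (rule continuous_constant_on_closure[where S="{0<..<b}" and f="?u"])
    show "continuous_on (closure {0<..<b}) ?u" using uc b by simp
    show "x \<in> closure {0<..<b}" using x b by simp
  qed (rule mid)
  have "f x = f 0 + ?J x" if "x \<in> {0..b}" for x
    using const[OF that] const[of 0] J0 b by simp
  then show ?thesis unfolding antideriv_on_def using h by blast
qed

section \<open>Integration by parts for the Mittag-Leffler kernel\<close>

text \<open>Adjointness moves the convolution from \<open>h\<close> to \<open>g\<close>, and
  \<open>rconv k b g\<close> is regular enough for integration by parts against \<open>f\<close>.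
  The integrals are added because the right-sided derivative carries a minus sign.\<close>

lemma rconv_by_parts:
  assumes b: "b > 0" and k: "continuous_on UNIV k"
    and f: "antideriv_on b f h" and g: "antideriv_on b g g'"
  shows "(LINT t:{0..b}|lborel. lconv k h t * g t) +
      (LINT t:{0..b}|lborel. f t * vector_derivative (rconv k b g) (at t within {0..b})) =
      f b * rconv k b g b - f 0 * rconv k b g 0"
proof -
  obtain P where P: "continuous_on {0..b} P"
    "\<And>t. t \<in> {0..b} \<Longrightarrow> (rconv k b g has_vector_derivative P t) (at t within {0..b})"
    by (rule rconv_C1[OF k g]) (rule that)
  have "(LINT t:{0..b}|lborel. lconv k h t * g t) = (LINT t:{0..b}|lborel. h t * rconv k b g t)"
    by (intro triangle_Fubini k antideriv_onD[OF f] borel_integrable_atLeastAtMost' antideriv_on_continuous[OF g])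
  moreover have "(LINT t:{0..b}|lborel. f t * vector_derivative (rconv k b g) (at t within {0..b})) =
      (LINT t:{0..b}|lborel. f t * P t)"
    \<comment> \<open>Derivatives relative to a nondegenerate interval are unique, end points
      included.\<close>
    using vector_derivative_within_closed_interval[OF b _ P(2)]
    by (intro set_lebesgue_integral_cong) auto
  ultimately show ?thesis
    using integration_by_parts_C1[OF _ f P] b by simp
qed

lemma lconv_by_parts:
  assumes b: "b > 0" and k: "continuous_on UNIV k"
    and f: "antideriv_on b f h" and g: "antideriv_on b g g'"
  shows "(LINT t:{0..b}|lborel. rconv k b h t * g t) +
      (LINT t:{0..b}|lborel. f t * vector_derivative (lconv k g) (at t within {0..b})) =
      f b * lconv k g b - f 0 * lconv k g 0"
proof -
  obtain P where P: "continuous_on {0..b} P"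
    "\<And>t. t \<in> {0..b} \<Longrightarrow> (lconv k g has_vector_derivative P t) (at t within {0..b})"
    by (rule lconv_C1[OF k g]) (rule that)
  \<comment> \<open>The same adjointness, now with \<open>g\<close> and \<open>h\<close> in
    exchanged roles.\<close>
  have "(LINT t:{0..b}|lborel. lconv k g t * h t) = (LINT t:{0..b}|lborel. g t * rconv k b h t)"
    by (intro triangle_Fubini k antideriv_onD[OF f] borel_integrable_atLeastAtMost' antideriv_on_continuous[OF g])
  then have "(LINT t:{0..b}|lborel. rconv k b h t * g t) = (LINT t:{0..b}|lborel. h t * lconv k g t)"
    by (simp add: mult.commute)
  moreover have "(LINT t:{0..b}|lborel. f t * vector_derivative (lconv k g) (at t within {0..b})) =
      (LINT t:{0..b}|lborel. f t * P t)"
    using vector_derivative_within_closed_interval[OF b _ P(2)]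
    by (intro set_lebesgue_integral_cong) auto
  ultimately show ?thesis
    using integration_by_parts_C1[OF _ f P] b by simp
qed

section \<open>The fractional operators as convolutions with the kernel\<close>

lemma left_integral_eq_lconv:
  "(LINT x:{0..t}|lborel. \<phi> x * mittag_leffler \<alpha> (- \<alpha> * ((t - x) powr \<alpha> / (1 - \<alpha>)))) = lconv (ml_kernel \<alpha>) \<phi> t"
  \<comment> \<open>On the range of integration \<open>t - x\<close> is nonnegative, so the absolute
    value in \<open>ml_kernel\<close> drops out.\<close>
  unfolding lconv_def by (intro set_lebesgue_integral_cong) (auto simp: ml_kernel_def)

lemma right_integral_eq_rconv:
  "(LINT x:{t..b}|lborel. \<phi> x * mittag_leffler \<alpha> (- \<alpha> * ((x - t) powr \<alpha> / (1 - \<alpha>)))) = rconv (ml_kernel \<alpha>) b \<phi> t"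
  unfolding rconv_def by (intro set_lebesgue_integral_cong) (auto simp: ml_kernel_def)

text \<open>Needed because for \<open>\<mu> = 1\<close> the factor \<open>0 powr 0\<close> is
  \<open>0\<close> instead of \<open>1\<close> at the end point \<open>x = t\<close>.\<close>

lemma set_integral_cong_except_point:
  fixes F G :: "real \<Rightarrow> real"
  assumes "\<And>x. x \<in> A \<Longrightarrow> x \<noteq> a \<Longrightarrow> F x = G x"
  shows "(LINT x:A|lborel. F x) = (LINT x:A|lborel. G x)"
  unfolding set_lebesgue_integral_def
  by (rule integral_discrete_difference[where X="{a}"]) (use assms in \<open>auto simp: indicator_def\<close>)

lemma gen_frac_int_left_eq_lconv:
  "gen_frac_int_left 1 \<alpha> 1 (- \<alpha> / (1 - \<alpha>)) 0 \<phi> t = lconv (ml_kernel \<alpha>) \<phi> t"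
  unfolding gen_frac_int_left_def lconv_def
  by (rule set_integral_cong_except_point[where a=t]) (auto simp: gen_mittag_leffler_1 ml_kernel_def)

lemma gen_frac_int_right_eq_rconv:
  "gen_frac_int_right 1 \<alpha> 1 (- \<alpha> / (1 - \<alpha>)) b \<phi> t = rconv (ml_kernel \<alpha>) b \<phi> t"
  unfolding gen_frac_int_right_def rconv_def
  by (rule set_integral_cong_except_point[where a=t]) (auto simp: gen_mittag_leffler_1 ml_kernel_def)

theorem proposition2p4:
  fixes b \<alpha> :: real and B f g :: "real \<Rightarrow> real"
  assumes "b > 0" and "0 < \<alpha>" and "\<alpha> < 1" and "B \<alpha> > 0"
    and "f \<in> H1 b" and "g \<in> H1 b"
  shows "(LINT t:{0..b}|lborel. ABC_left B b \<alpha> f t * g t) =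
           (LINT t:{0..b}|lborel. f t * ABR_right B b \<alpha> g t) +
           B \<alpha> / (1 - \<alpha>) *
             (f b * gen_frac_int_right 1 \<alpha> 1 (- \<alpha> / (1 - \<alpha>)) b g b -
              f 0 * gen_frac_int_right 1 \<alpha> 1 (- \<alpha> / (1 - \<alpha>)) b g 0)
       \<and> (LINT t:{0..b}|lborel. ABC_right B b \<alpha> f t * g t) =
           (LINT t:{0..b}|lborel. f t * ABR_left B b \<alpha> g t) -
           B \<alpha> / (1 - \<alpha>) *
             (f b * gen_frac_int_left 1 \<alpha> 1 (- \<alpha> / (1 - \<alpha>)) 0 g b -
              f 0 * gen_frac_int_left 1 \<alpha> 1 (- \<alpha> / (1 - \<alpha>)) 0 g 0)"
proof -
  let ?k = "ml_kernel \<alpha>" and ?C = "B \<alpha> / (1 - \<alpha>)" and ?h = "weak_deriv b f"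
  have k: "continuous_on UNIV ?k" using assms by (intro continuous_on_ml_kernel)
  have f: "antideriv_on b f ?h" and g: "antideriv_on b g (weak_deriv b g)"
    using assms by (auto intro: H1_antideriv_on)
  have int: "(LINT t:{0..b}|lborel. c * u t * v t) = c * (LINT t:{0..b}|lborel. u t * v t)"
    "(LINT t:{0..b}|lborel. u t * (c * v t)) = c * (LINT t:{0..b}|lborel. u t * v t)"
    for c :: real and u v :: "real \<Rightarrow> real"
    by (simp_all only: mult.assoc mult.left_commute[of _ c] set_integral_mult_right)
  show ?thesis
    \<comment> \<open>The boundary terms are rewritten as sums of the two integrals; after pulling
      out the constant, distributivity closes both identities.\<close>
    unfolding ABC_left_def ABC_right_def ABR_left_def ABR_right_def left_integral_eq_lconv
      right_integral_eq_rconv gen_frac_int_left_eq_lconv gen_frac_int_right_eq_rconv int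
      rconv_by_parts[OF assms(1) k f g, symmetric] lconv_by_parts[OF assms(1) k f g, symmetric]
    by (simp add: distrib_left)
qed

end
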